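(* Let $(N,A,c)$ be a public bads instance and consider the optimization program $$\text{maximize}_{\beta\ge0}\ -\sum_{i\in N}\tfrac1n\log\beta_i\quad\text{subject to}\quad \sum_{i\in N}c_i(a)\beta_i\ge1\ \text{ for all }a\in A.$$ The KKT points $(\beta,x)$ of this program, where $x=(x_a)_{a\in A}$ denotes the multipliers of the constraints, are in one-to-one correspondence with the allocations $x\in\Delta(A)$ that are proportionally fair and satisfy $c_i(x)>0$ for all $i\in N$; that is, $(\beta,x)\mapsto x$ is a bijection from the set of KKT points onto the set of such allocations.
   Context: A public bads instance $(N,A,c)$ consists of agents $N=\{1,\dots,n\}$, a finite set $A$ of alternatives (bads), and cost functions $c_i:A\to\mathbb{R}_{\ge 0}$, $i\in N$. $\Delta(A)$ is the set of lotteries (probability vectors) on $A$; $c_i(x)=\sum_{a\in A}x(a)c_i(a)$ (we write $x_a=x(a)$) and $c(x)=(c_i(x))_{i\in N}$. Standing assumptions: $0\notin\{c(x):x\in\Delta(A)\}$, and for every $i\in N$ there is $a\in A$ with $c_i(a)<\max_{a'\in A}c_i(a')$. Proportional fairness: $x\in\Delta(A)$ is proportionally fair if $\frac1n\sum_{i\in N}\frac{c_i(y)}{c_i(x)}\ge 1$ for all $y\in\Delta(A)$, with conventions $0/0=1$ and $\alpha/0=+\infty$ for $\alpha>0$. KKT points: a pair $(\beta,x)\in\mathbb{R}^N\times\mathbb{R}^A$ is a KKT point of the program if (1) $\beta$ is feasible for the program and $\beta_i>0$ for all $i$ (implicit domain constraint of the logarithm); (2) $x_a\ge0$ for all $a\in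 A$; (3) $\frac{1}{n\beta_i}=\sum_{a\in A}c_i(a)x_a$ for each $i\in N$; (4) $x_a\bigl(\sum_{i\in N}c_i(a)\beta_i-1\bigr)=0$ for all $a\in A$. *)

theory Defs
  imports Complex_Main "HOL-Library.FuncSet" "HOL-Library.Extended_Real"
begin

text \<open>
  The agents are \<open>{1..n}\<close>. A vector in \<open>\<real>\<^sup>N\<close> or \<open>\<real>\<^sup>A\<close> is an extensional function on the index set,
  that is, it equals \<open>undefined\<close> outside of it. In this way vectors with the same
  coordinates are equal, so that bijections between sets of vectors mean what they should.
\<close>

definition lotteries :: "'a set \<Rightarrow> ('a \<Rightarrow> real) set" where
  "lotteries A = {x \<in> A \<rightarrow>\<^sub>E UNIV. (\<forall>a\<in>A. 0 \<le> x a) \<and> (\<Sum>a\<in>A. x a) = 1}"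

definition lottery_cost :: "'a set \<Rightarrow> (nat \<Rightarrow> 'a \<Rightarrow> real) \<Rightarrow> nat \<Rightarrow> ('a \<Rightarrow> real) \<Rightarrow> real" where
  "lottery_cost A c i x = (\<Sum>a\<in>A. x a * c i a)"

definition cost_vector ::
    "nat \<Rightarrow> 'a set \<Rightarrow> (nat \<Rightarrow> 'a \<Rightarrow> real) \<Rightarrow> ('a \<Rightarrow> real) \<Rightarrow> (nat \<Rightarrow> real)" where
  "cost_vector n A c x = (\<lambda>i\<in>{1..n}. lottery_cost A c i x)"

text \<open>
  The last two conjuncts are the standing assumptions. They force \<open>A\<close> to be nonempty, so
  the maximum is taken over a finite nonempty set.
\<close>

definition public_bads_instance :: "nat \<Rightarrow> 'a set \<Rightarrow> (nat \<Rightarrow> 'a \<Rightarrow> real) \<Rightarrow> bool" where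
  "public_bads_instance n A c \<longleftrightarrow>
     1 \<le> n \<and> finite A \<and>
     (\<forall>i\<in>{1..n}. \<forall>a\<in>A. 0 \<le> c i a) \<and>
     (\<lambda>i\<in>{1..n}. 0) \<notin> cost_vector n A c ` lotteries A \<and>
     (\<forall>i\<in>{1..n}. \<exists>a\<in>A. c i a < Max (c i ` A))"

text \<open>
  Quotient of nonnegative reals with the conventions \<open>0/0 = 1\<close> and \<open>\<alpha>/0 = \<infinity>\<close> for \<open>\<alpha> > 0\<close>;
  these differ from both real and extended real division of the library.
\<close>

definition cost_ratio :: "real \<Rightarrow> real \<Rightarrow> ereal" where
  "cost_ratio p q = (if q = 0 then (if p = 0 then 1 else \<infinity>) else ereal (p / q))"

definition proportionally_fair ::
    "nat \<Rightarrow> 'a set \<Rightarrow> (nat \<Rightarrow> 'a \<Rightarrow> real) \<Rightarrow> ('a \<Rightarrow> real) \<Rightarrow> bool" where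
  "proportionally_fair n A c x \<longleftrightarrow>
     x \<in> lotteries A \<and>
     (\<forall>y\<in>lotteries A.
        ereal (1 / real n) * (\<Sum>i\<in>{1..n}. cost_ratio (lottery_cost A c i y) (lottery_cost A c i x)) \<ge> 1)"

text \<open>
  The program is: maximize \<open>- (\<Sum>i\<in>{1..n}. 1/n * ln (\<beta> i))\<close> over the following feasible set.
\<close>

definition feasible :: "nat \<Rightarrow> 'a set \<Rightarrow> (nat \<Rightarrow> 'a \<Rightarrow> real) \<Rightarrow> (nat \<Rightarrow> real) set" where
  "feasible n A c =
     {\<beta> \<in> {1..n} \<rightarrow>\<^sub>E UNIV. (\<forall>i\<in>{1..n}. 0 \<le> \<beta> i) \<and> (\<forall>a\<in>A. (\<Sum>i\<in>{1..n}. c i a * \<beta> i) \<ge> 1)}"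

text \<open>
  Stationarity carries no multipliers for \<open>\<beta> \<ge> 0\<close>: the domain of the logarithm forces
  \<open>\<beta> i > 0\<close>, so those constraints are never active. The multiplier vector \<open>x\<close> is not
  required to be a lottery.
\<close>

definition kkt_points ::
    "nat \<Rightarrow> 'a set \<Rightarrow> (nat \<Rightarrow> 'a \<Rightarrow> real) \<Rightarrow> ((nat \<Rightarrow> real) \<times> ('a \<Rightarrow> real)) set" where
  "kkt_points n A c =
     {(\<beta>, x). \<beta> \<in> feasible n A c \<and> (\<forall>i\<in>{1..n}. 0 < \<beta> i) \<and>
        x \<in> A \<rightarrow>\<^sub>E UNIV \<and> (\<forall>a\<in>A. 0 \<le> x a) \<and>
        (\<forall>i\<in>{1..n}. 1 / (real n * \<beta> i) = (\<Sum>a\<in>A. c i a * x a)) \<and>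
        (\<forall>a\<in>A. x a * ((\<Sum>i\<in>{1..n}. c i a * \<beta> i) - 1) = 0)}"

end

theory Submission
  imports Defs
begin

text \<open>
  Stationarity forces \<open>\<beta> i = 1 / (n * c\<^sub>i(x))\<close>, so \<open>\<beta>\<close> is determined by \<open>x\<close>, and for a lottery \<open>y\<close>
  the quantity \<open>\<Sum>i. \<beta> i * c\<^sub>i(y)\<close> is the left-hand side of the proportional fairness condition.
  As it is also the \<open>y\<close>-average of the constraint values \<open>\<Sum>i. c i a * \<beta> i\<close>, feasibility of \<open>\<beta>\<close> is
  equivalent to proportional fairness of \<open>x\<close>. At \<open>y = x\<close> the quantity is always 1, which makes
  complementary slackness equivalent to \<open>x\<close> having total mass 1.
\<close>

text \<open>The restriction makes the vector extensional, as \<open>feasible\<close> demands, so it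
  can equal \<open>\<beta>\<close> as a function.\<close>

definition fair_weights :: "nat \<Rightarrow> 'a set \<Rightarrow> (nat \<Rightarrow> 'a \<Rightarrow> real) \<Rightarrow> ('a \<Rightarrow> real) \<Rightarrow> nat \<Rightarrow> real" where
  "fair_weights n A c x = (\<lambda>i\<in>{1..n}. 1 / (real n * lottery_cost A c i x))"

lemma weighted_lottery_cost:
  "(\<Sum>i\<in>I. \<beta> i * lottery_cost A c i y) = (\<Sum>a\<in>A. y a * (\<Sum>i\<in>I. c i a * \<beta> i))"
  unfolding lottery_cost_def sum_distrib_left
  by (subst sum.swap) (simp add: mult_ac)

lemma weighted_lottery_cost_self:
  assumes "1 \<le> n" "\<forall>i\<in>{1..n}. lottery_cost A c i x > 0"
  shows "(\<Sum>i\<in>{1..n}. fair_weights n A c x i * lottery_cost A c i x) = 1"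
proof -
  have "(\<Sum>i\<in>{1..n}. fair_weights n A c x i * lottery_cost A c i x) = (\<Sum>i\<in>{1..n}. 1 / real n)"
    using assms by (intro sum.cong refl) (force simp: fair_weights_def)
  then show ?thesis
    using assms(1) by simp
qed

text \<open>Positive costs at \<open>x\<close> rule out the conventions for zero denominators, so
  every \<open>cost_ratio\<close> is a finite quotient and the condition moves from
  \<open>ereal\<close> to the reals.\<close>

lemma proportionally_fair_iff:
  assumes "\<forall>i\<in>{1..n}. lottery_cost A c i x > 0"
  shows "proportionally_fair n A c x \<longleftrightarrow> x \<in> lotteries A \<and>
    (\<forall>y\<in>lotteries A. 1 \<le> (\<Sum>i\<in>{1..n}. fair_weights n A c x i * lottery_cost A c i y))"
proof -
  have "ereal (1 / real n) * (\<Sum>i\<in>{1..n}. cost_ratio (lottery_cost A c i y) (lottery_cost A c i x))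
    = ereal (\<Sum>i\<in>{1..n}. fair_weights n A c x i * lottery_cost A c i y)" for y
  proof -
    have "(\<Sum>i\<in>{1..n}. cost_ratio (lottery_cost A c i y) (lottery_cost A c i x))
      = (\<Sum>i\<in>{1..n}. ereal (lottery_cost A c i y / lottery_cost A c i x))"
      using assms by (intro sum.cong refl) (force simp: cost_ratio_def)
    moreover have "1 / real n * (\<Sum>i\<in>{1..n}. lottery_cost A c i y / lottery_cost A c i x)
      = (\<Sum>i\<in>{1..n}. fair_weights n A c x i * lottery_cost A c i y)"
      unfolding sum_distrib_left by (intro sum.cong refl) (simp add: fair_weights_def)
    ultimately show ?thesis
      by (metis sum_ereal times_ereal.simps(1))
  qed
  then show ?thesis
    by (simp add: proportionally_fair_def)
qed

lemma point_mass_in_lotteries: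
  assumes "finite A" "a \<in> A"
  shows "(\<lambda>b\<in>A. if b = a then 1 else 0) \<in> lotteries A"
  using assms by (auto simp: lotteries_def)

text \<open>The average is linear in \<open>y\<close>, so testing the vertices of the simplex, the
  point masses, suffices.\<close>

lemma average_ge_1_iff:
  assumes "finite A"
  shows "(\<forall>y\<in>lotteries A. 1 \<le> (\<Sum>a\<in>A. y a * f a)) \<longleftrightarrow> (\<forall>a\<in>A. 1 \<le> f a)"
proof safe
  fix a assume avg: "\<forall>y\<in>lotteries A. 1 \<le> (\<Sum>a\<in>A. y a * f a)" and a: "a \<in> A"
  let ?y = "\<lambda>b\<in>A. if b = a then 1 else 0 :: real"
  have "(\<Sum>b\<in>A. ?y b * f b) = (\<Sum>b\<in>A. if b = a then f b else 0)"
    by (intro sum.cong) auto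
  then show "1 \<le> f a"
    using avg point_mass_in_lotteries[OF assms a] assms a by auto
next
  fix y assume f: "\<forall>a\<in>A. 1 \<le> f a" and y: "y \<in> lotteries A"
  have "1 = (\<Sum>a\<in>A. y a * 1)"
    using y by (simp add: lotteries_def)
  also have "\<dots> \<le> (\<Sum>a\<in>A. y a * f a)"
    using f y by (intro sum_mono mult_left_mono) (auto simp: lotteries_def)
  finally show "1 \<le> (\<Sum>a\<in>A. y a * f a)" .
qed

text \<open>With \<open>\<beta>\<close> displayed as a function of \<open>x\<close>, injectivity and
  surjectivity of the projection to \<open>x\<close> can be read off.\<close>

lemma kkt_points_iff:
  assumes n: "1 \<le> n" and A: "finite A"
  shows "(\<beta>, x) \<in> kkt_points n A c \<longleftrightarrow> \<beta> = fair_weights n A c x \<and> x \<in> lotteries A \<and>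
    proportionally_fair n A c x \<and> (\<forall>i\<in>{1..n}. lottery_cost A c i x > 0)"
    (is "_ \<longleftrightarrow> ?R")
proof
  assume kkt: "(\<beta>, x) \<in> kkt_points n A c"
  have stat: "lottery_cost A c i x = 1 / (real n * \<beta> i)" "0 < \<beta> i" if "i \<in> {1..n}" for i
    using kkt that by (auto simp: kkt_points_def lottery_cost_def mult_ac)
  have pos: "\<forall>i\<in>{1..n}. lottery_cost A c i x > 0"
    using stat n by simp
  have \<beta>: "\<beta> = fair_weights n A c x"
  proof
    fix i show "\<beta> i = fair_weights n A c x i"
    proof (cases "i \<in> {1..n}")
      case True
      then show ?thesis
        using n stat(1) by (simp add: fair_weights_def)
    next
      \<comment> \<open>Outside the index set both vectors are \<open>undefined\<close>.\<close>
      case False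
      moreover have "\<beta> \<in> {1..n} \<rightarrow>\<^sub>E UNIV"
        using kkt by (simp add: kkt_points_def feasible_def)
      ultimately show ?thesis
        using PiE_arb[of \<beta>] by (simp add: fair_weights_def del: atLeastAtMost_iff)
    qed
  qed
  \<comment> \<open>Complementary slackness says
    \<open>x a = x a * (\<Sum>i\<in>{1..n}. c i a * \<beta> i)\<close>; summed over
    \<open>A\<close>, the right-hand side is the weighted cost of \<open>x\<close> itself.\<close>
  have "(\<Sum>a\<in>A. x a) = (\<Sum>a\<in>A. x a * (\<Sum>i\<in>{1..n}. c i a * \<beta> i))"
    using kkt by (intro sum.cong) (auto simp: kkt_points_def)
  then have "(\<Sum>a\<in>A. x a) = 1"
    using weighted_lottery_cost_self[OF n pos] by (simp add: weighted_lottery_cost \<beta>)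
  then have x: "x \<in> lotteries A"
    using kkt by (simp add: kkt_points_def lotteries_def)
  have "\<forall>a\<in>A. 1 \<le> (\<Sum>i\<in>{1..n}. c i a * \<beta> i)"
    using kkt by (simp add: kkt_points_def feasible_def)
  then have "proportionally_fair n A c x"
    using x unfolding proportionally_fair_iff[OF pos] weighted_lottery_cost \<beta>
    by (simp add: average_ge_1_iff[OF A])
  then show ?R
    using \<beta> x pos by blast
next
  assume R: ?R
  then have \<beta>: "\<beta> = fair_weights n A c x" and x: "x \<in> lotteries A"
    and pos: "\<forall>i\<in>{1..n}. lottery_cost A c i x > 0" by auto
  let ?g = "\<lambda>a. \<Sum>i\<in>{1..n}. c i a * \<beta> i"
  have \<beta>_pos: "\<forall>i\<in>{1..n}. 0 < \<beta> i"
    using pos n by (simp add: \<beta> fair_weights_def)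
  have feas: "\<forall>a\<in>A. 1 \<le> ?g a"
    using R unfolding proportionally_fair_iff[OF pos] weighted_lottery_cost \<beta>
    by (simp add: average_ge_1_iff[OF A])
  \<comment> \<open>The total slack is the weighted cost of \<open>x\<close> minus its mass, that
    is, \<open>1 - 1\<close>. Feasibility makes each term nonnegative, so each vanishes.\<close>
  have "(\<Sum>a\<in>A. x a * (?g a - 1)) = 0"
    using weighted_lottery_cost_self[OF n pos] x
    by (simp add: weighted_lottery_cost \<beta> right_diff_distrib sum_subtractf lotteries_def)
  moreover have "\<forall>a\<in>A. 0 \<le> x a * (?g a - 1)"
    using feas x by (simp add: lotteries_def)
  ultimately have slack: "\<forall>a\<in>A. x a * (?g a - 1) = 0"
    using A by (simp add: sum_nonneg_eq_0_iff del: mult_eq_0_iff)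
  have "\<forall>i\<in>{1..n}. 1 / (real n * \<beta> i) = (\<Sum>a\<in>A. c i a * x a)"
    \<comment> \<open>The double reciprocal cancels while \<open>lottery_cost\<close> is still
      folded; only then is the sum exposed.\<close>
    using n by (simp add: \<beta> fair_weights_def) (simp add: lottery_cost_def mult_ac)
  moreover have "\<beta> \<in> feasible n A c"
    using feas \<beta>_pos unfolding feasible_def by (auto simp: \<beta> fair_weights_def less_imp_le)
  ultimately show "(\<beta>, x) \<in> kkt_points n A c"
    using \<beta>_pos x slack by (simp add: kkt_points_def lotteries_def)
qed

theorem proposition6p3:
  fixes n :: nat and A :: "'a set" and c :: "nat \<Rightarrow> 'a \<Rightarrow> real"
  assumes "public_bads_instance n A c"
  shows "bij_betw (\<lambda>(\<beta>, x). x) (kkt_points n A c)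
           {x \<in> lotteries A. proportionally_fair n A c x \<and> (\<forall>i\<in>{1..n}. lottery_cost A c i x > 0)}"
proof -
  have "1 \<le> n" "finite A"
    using assms by (auto simp: public_bads_instance_def)
  note iff = kkt_points_iff[OF this]
  show ?thesis
    \<comment> \<open>The inverse map restores the \<open>\<beta>\<close> that stationarity
      dictates.\<close>
    by (rule bij_betw_byWitness[where f' = "\<lambda>x. (fair_weights n A c x, x)"]) (auto simp: iff)
qed

end
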